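(* Let $c\in(0,1)$ be a universal constant for which the Sudakov minoration bound stated in the context holds. Let $T$ be a finite set with $|T|\ge 2$ and let $X=(X_t)_{t\in T}$ be a centered (jointly) Gaussian process with $\mathbf{E}|X_s-X_t|^2>0$ for all $s\ne t$. Let $d(s,t):=(\mathbf{E}|X_s-X_t|^2)^{1/2}$ and $a:=\min\{d(s,t): s,t\in T,\ s\neq t\}$. Then there exists a threshold $0<\beta_*<\infty$, depending on the covariance structure of $(X_t)_{t\in T}$, such that $$g(\beta)\ge c\,a\sqrt{\mathbf{E} D(\nu_\beta\|\nu_0)}\qquad\text{for all }\beta\ge\beta_*.$$
   Context: For $\beta\ge 0$, the random Gibbs measure $\nu_\beta$ on $T$ is the probability measure with $\nu_\beta(t)=e^{\beta X_t}/Z(\beta)$, $t\in T$, where $Z(\beta)=\sum_{t\in T}e^{\beta X_t}$; in particular $\nu_0$ is the uniform distribution on $T$. The quenched Gibbs average is $g(\beta):=\mathbf{E}\big[\frac{1}{Z(\beta)}\sum_{t\in T}X_te^{\beta X_t}\big]$. $D(\mu\|\nu)=\sum_{t\in T}\mu(t)\log\frac{\mu(t)}{\nu(t)}$ is the Kullback–Leibler divergence (natural logarithm), and $\mathbf{E}$ is expectation with respect to $X$. Sudakov minoration (known result fixing the constant $c$): there is a universal constant $0<c<1$ such that for every finite index set $T$ with $|T|\ge2$ and every centered Gaussian process $(X_t)_{t\in T}$ with $(\mathbf{E}|X_s-X_t|^2)^{1/2}\ge a>0$ for all distinct $s,t\in T$, one has $\mathbf{E}[\max_{t\in T}X_t]\ge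 c\,a\sqrt{\log|T|}$. *)

theory Defs
  imports "HOL-Probability.Probability"
begin

text \<open>
  A process indexed by \<^term>\<open>T\<close> is a function \<open>X :: 't \<Rightarrow> 'w \<Rightarrow> real\<close>, of which only the values
  \<open>X t\<close> with \<open>t \<in> T\<close> matter. Expectations are Bochner integrals over a probability space \<open>M\<close>;
  for finite \<open>T\<close> and Gaussian \<open>X\<close> all integrands below are integrable.
\<close>

text \<open>The normal law with mean zero; variance zero (the point mass at 0) is allowed.\<close>

definition centered_gaussian :: "'w measure \<Rightarrow> ('w \<Rightarrow> real) \<Rightarrow> bool" where
  "centered_gaussian M Y \<longleftrightarrow>
     Y \<in> borel_measurable M \<and>
     ((\<exists>\<sigma>>0. distributed M lborel Y (\<lambda>x. ennreal (normal_density 0 \<sigma> x))) \<or> (AE \<omega> in M. Y \<omega> = 0))"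

text \<open>Joint Gaussianity: every linear combination is a (possibly degenerate) Gaussian variable.\<close>

definition centered_gaussian_process :: "'w measure \<Rightarrow> 't set \<Rightarrow> ('t \<Rightarrow> 'w \<Rightarrow> real) \<Rightarrow> bool" where
  "centered_gaussian_process M T X \<longleftrightarrow>
     (\<forall>u :: 't \<Rightarrow> real. centered_gaussian M (\<lambda>\<omega>. \<Sum>t\<in>T. u t * X t \<omega>))"

text \<open>The covariance of a centered process, set to 0 outside \<open>T \<times> T\<close> so that it carries no
  information about \<open>X t\<close> with \<open>t \<notin> T\<close>.\<close>

definition covariance :: "'w measure \<Rightarrow> 't set \<Rightarrow> ('t \<Rightarrow> 'w \<Rightarrow> real) \<Rightarrow> 't \<Rightarrow> 't \<Rightarrow> real" where
  "covariance M T X s t = (if s \<in> T \<and> t \<in> T then (\<integral>\<omega>. X s \<omega> * X t \<omega> \<partial>M) else 0)"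

definition canonical_dist :: "'w measure \<Rightarrow> ('t \<Rightarrow> 'w \<Rightarrow> real) \<Rightarrow> 't \<Rightarrow> 't \<Rightarrow> real" where
  "canonical_dist M X s t = sqrt (\<integral>\<omega>. \<bar>X s \<omega> - X t \<omega>\<bar>\<^sup>2 \<partial>M)"

definition min_dist :: "'w measure \<Rightarrow> 't set \<Rightarrow> ('t \<Rightarrow> 'w \<Rightarrow> real) \<Rightarrow> real" where
  "min_dist M T X = Min {canonical_dist M X s t | s t. s \<in> T \<and> t \<in> T \<and> s \<noteq> t}"

definition partition_function :: "'t set \<Rightarrow> ('t \<Rightarrow> 'w \<Rightarrow> real) \<Rightarrow> real \<Rightarrow> 'w \<Rightarrow> real" where
  "partition_function T X \<beta> \<omega> = (\<Sum>t\<in>T. exp (\<beta> * X t \<omega>))"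

text \<open>The Gibbs measure, given by its probability mass function on \<open>T\<close>.\<close>

definition gibbs :: "'t set \<Rightarrow> ('t \<Rightarrow> 'w \<Rightarrow> real) \<Rightarrow> real \<Rightarrow> 'w \<Rightarrow> 't \<Rightarrow> real" where
  "gibbs T X \<beta> \<omega> t = exp (\<beta> * X t \<omega>) / partition_function T X \<beta> \<omega>"

definition gibbs_average :: "'w measure \<Rightarrow> 't set \<Rightarrow> ('t \<Rightarrow> 'w \<Rightarrow> real) \<Rightarrow> real \<Rightarrow> real" where
  "gibbs_average M T X \<beta> =
     (\<integral>\<omega>. 1 / partition_function T X \<beta> \<omega> * (\<Sum>t\<in>T. X t \<omega> * exp (\<beta> * X t \<omega>)) \<partial>M)"

definition KL_div :: "'t set \<Rightarrow> ('t \<Rightarrow> real) \<Rightarrow> ('t \<Rightarrow> real) \<Rightarrow> real" where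
  "KL_div T \<mu> \<nu> = (\<Sum>t\<in>T. \<mu> t * ln (\<mu> t / \<nu> t))"

text \<open>This is the library's divergence of measures on \<open>T\<close>, which takes the reference measure first.\<close>

lemma KL_div_eq_KL_divergence:
  fixes \<mu> \<nu> :: "'t \<Rightarrow> real"
  assumes "finite T" "\<And>t. t \<in> T \<Longrightarrow> 0 \<le> \<mu> t" "\<And>t. t \<in> T \<Longrightarrow> 0 < \<nu> t"
  shows "KL_div T \<mu> \<nu> = KL_divergence (exp 1) (point_measure T \<nu>) (point_measure T \<mu>)"
proof -
  interpret finite_measure "count_space T"
    using assms(1) by (rule finite_measure_count_space)
  have "KL_divergence (exp 1) (density (count_space T) \<nu>) (density (count_space T) \<mu>)
      = (\<integral>t. \<mu> t * log (exp 1) (\<mu> t / \<nu> t) \<partial>count_space T)"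
    using assms by (intro KL_density_density) (force simp: AE_count_space less_imp_le)+
  also have "\<dots> = KL_div T \<mu> \<nu>"
    using assms(1) by (simp add: lebesgue_integral_count_space_finite KL_div_def log_def)
  finally show ?thesis
    by (simp add: point_measure_def)
qed

text \<open>
  \<open>c\<close> satisfies the Sudakov minoration bound for all finite Gaussian processes. Since one cannot
  quantify over types, the index sets are finite sets of naturals and the sample space is
  \<open>nat \<Rightarrow> real\<close>. This loses no generality: after relabelling \<open>T\<close>, the law of a process on
  \<open>T\<close> lives on that space (lemma \<open>sudakov_boundD\<close>).
\<close>

definition sudakov_bound :: "real \<Rightarrow> bool" where
  "sudakov_bound c \<longleftrightarrow>
     (\<forall>(T :: nat set) (M :: (nat \<Rightarrow> real) measure) X a.
        finite T \<longrightarrow> 2 \<le> card T \<longrightarrow> prob_space M \<longrightarrow> centered_gaussian_process M T X \<longrightarrow> 0 < a \<longrightarrow>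
        (\<forall>s\<in>T. \<forall>t\<in>T. s \<noteq> t \<longrightarrow> a \<le> canonical_dist M X s t) \<longrightarrow>
        c * a * sqrt (ln (real (card T))) \<le> (\<integral>\<omega>. Max ((\<lambda>t. X t \<omega>) ` T) \<partial>M))"

lemma centered_gaussian_distr:
  assumes \<Phi>: "\<Phi> \<in> measurable M N" and Y: "Y \<in> borel_measurable N"
  shows "centered_gaussian (distr M N \<Phi>) Y \<longleftrightarrow> centered_gaussian M (\<lambda>\<omega>. Y (\<Phi> \<omega>))"
proof -
  have Y': "(\<lambda>\<omega>. Y (\<Phi> \<omega>)) \<in> borel_measurable M"
    using measurable_compose[OF \<Phi> Y] .
  have "distr (distr M N \<Phi>) lborel Y = distr M lborel (\<lambda>\<omega>. Y (\<Phi> \<omega>))"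
    using \<Phi> Y by (subst distr_distr) (auto simp: comp_def)
  moreover have "(AE x in distr M N \<Phi>. Y x = 0) \<longleftrightarrow> (AE \<omega> in M. Y (\<Phi> \<omega>) = 0)"
    using \<Phi> Y by (intro AE_distr_iff) auto
  ultimately show ?thesis
    using Y Y' by (simp add: centered_gaussian_def distributed_def)
qed

lemma centered_gaussian_process_measurable:
  assumes "centered_gaussian_process M T X" "finite T" "t \<in> T"
  shows "X t \<in> borel_measurable M"
proof -
  have "centered_gaussian M (\<lambda>\<omega>. \<Sum>s\<in>T. (if s = t then 1 else 0) * X s \<omega>)"
    using assms(1) unfolding centered_gaussian_process_def by (rule spec)
  moreover have "(\<Sum>s\<in>T. (if s = t then 1 else 0) * X s \<omega>) = X t \<omega>" for \<omega>
    using assms(2,3) by (simp add: if_distrib[of "\<lambda>z. z * _"] cong: if_cong)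
  ultimately show ?thesis
    by (simp add: centered_gaussian_def)
qed

lemma sudakov_boundD:
  fixes T :: "'t set" and M :: "'w measure"
  assumes c: "sudakov_bound c" and T: "finite T" "2 \<le> card T" and M: "prob_space M"
    and G: "centered_gaussian_process M T X" and a: "0 < a"
    and sep: "\<And>s t. s \<in> T \<Longrightarrow> t \<in> T \<Longrightarrow> s \<noteq> t \<Longrightarrow> a \<le> canonical_dist M X s t"
  shows "c * a * sqrt (ln (real (card T))) \<le> (\<integral>\<omega>. Max ((\<lambda>t. X t \<omega>) ` T) \<partial>M)"
proof -
  interpret prob_space M by (rule M)
  define n where "n = card T"
  obtain e where e: "bij_betw e {..<n} T"
    using ex_bij_betw_nat_finite[OF T(1)] by (auto simp: n_def atLeast0LessThan)
  have eT: "e i \<in> T" if "i < n" for i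
    using e that by (auto simp: bij_betw_def)
  define P :: "(nat \<Rightarrow> real) measure" where "P = PiM UNIV (\<lambda>_. borel)"
  define \<Phi> where "\<Phi> = (\<lambda>\<omega> i. if i < n then X (e i) \<omega> else 0)"
  have mX: "X t \<in> borel_measurable M" if "t \<in> T" for t
    using centered_gaussian_process_measurable[OF G T(1) that] .
  have m\<Phi>: "\<Phi> \<in> measurable M P"
    unfolding P_def
  proof (rule measurable_PiM_single')
    show "(\<lambda>\<omega>. \<Phi> \<omega> i) \<in> borel_measurable M" for i
      by (cases "i < n") (simp_all add: \<Phi>_def mX eT)
  qed auto
  have mcoord[measurable]: "(\<lambda>x. x i) \<in> borel_measurable P" for i
    unfolding P_def by simp
  define N where "N = distr M P \<Phi>"
  define Y :: "nat \<Rightarrow> (nat \<Rightarrow> real) \<Rightarrow> real" where "Y = (\<lambda>i x. x i)"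
  have "centered_gaussian_process N {..<n} Y"
    unfolding centered_gaussian_process_def
  proof
    fix u :: "nat \<Rightarrow> real"
    let ?v = "\<lambda>t. u (the_inv_into {..<n} e t)"
    have "(\<Sum>t\<in>T. ?v t * X t \<omega>) = (\<Sum>i<n. u i * X (e i) \<omega>)" for \<omega>
      using e by (subst sum.reindex_bij_betw[OF e, symmetric])
        (auto intro!: sum.cong simp: the_inv_into_f_f bij_betw_def)
    moreover have "centered_gaussian M (\<lambda>\<omega>. \<Sum>t\<in>T. ?v t * X t \<omega>)"
      using G unfolding centered_gaussian_process_def by (rule spec)
    ultimately have "centered_gaussian M (\<lambda>\<omega>. \<Sum>i<n. u i * Y i (\<Phi> \<omega>))"
      by (simp add: Y_def \<Phi>_def)
    moreover have "(\<lambda>x. \<Sum>i<n. u i * Y i x) \<in> borel_measurable P"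
      unfolding Y_def by measurable
    ultimately show "centered_gaussian N (\<lambda>x. \<Sum>i<n. u i * Y i x)"
      unfolding N_def using centered_gaussian_distr[OF m\<Phi>] by simp
  qed
  moreover have "prob_space N"
    unfolding N_def using m\<Phi> by (rule prob_space_distr)
  moreover have "a \<le> canonical_dist N Y i j" if "i \<in> {..<n}" "j \<in> {..<n}" "i \<noteq> j" for i j
  proof -
    have "canonical_dist N Y i j = canonical_dist M X (e i) (e j)"
      unfolding canonical_dist_def N_def Y_def using that m\<Phi>
      by (subst integral_distr) (auto simp: \<Phi>_def)
    moreover have "e i \<noteq> e j"
      using e that by (auto simp: bij_betw_def inj_on_def)
    ultimately show ?thesis
      using sep eT that by simp
  qed
  ultimately have "c * a * sqrt (ln (real (card {..<n}))) \<le> (\<integral>x. Max ((\<lambda>i. Y i x) ` {..<n}) \<partial>N)"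
    using c[unfolded sudakov_bound_def, rule_format, of "{..<n}" N Y a] T(2) a by (simp add: n_def)
  also have "(\<integral>x. Max ((\<lambda>i. Y i x) ` {..<n}) \<partial>N) = (\<integral>\<omega>. Max ((\<lambda>t. X t \<omega>) ` T) \<partial>M)"
  proof -
    have "(\<lambda>x. Max ((\<lambda>i. Y i x) ` {..<n})) \<in> borel_measurable P"
      unfolding Y_def by (rule borel_measurable_Max) auto
    moreover have "(\<lambda>i. Y i (\<Phi> \<omega>)) ` {..<n} = (\<lambda>t. X t \<omega>) ` T" for \<omega>
      using e by (force simp: Y_def \<Phi>_def bij_betw_def)
    ultimately show ?thesis
      unfolding N_def using m\<Phi> by (subst integral_distr) auto
  qed
  finally show ?thesis
    by (simp add: n_def)
qed

end

theory Submission
  imports Defs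
begin

text \<open>
  Write \<open>L = ln |T|\<close> and let \<open>\<langle>X\<rangle>\<close> be the Gibbs average of \<open>X\<close>. Pointwise, \<open>D(\<nu>\<^sub>\<beta> \<parallel> \<nu>\<^sub>0) = \<beta> \<langle>X\<rangle> - ln Z(\<beta>) + L\<close>,
  and \<open>ln Z(\<beta>) \<ge> \<beta> max X\<close>, so \<open>E D \<le> L - \<beta> (E max X - g(\<beta>))\<close>. The tangent of the square root
  at \<open>L\<close> gives \<open>sqrt (E D) \<le> sqrt L - \<beta> (E max X - g(\<beta>)) / (2 sqrt L)\<close>; as soon as
  \<open>\<beta> c a \<ge> 2 sqrt L\<close>, Sudakov's bound \<open>E max X \<ge> c a sqrt L\<close> yields the claim.
\<close>

section \<open>Moments and covariance of a Gaussian process\<close>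

lemma centered_gaussian_integrable_power:
  assumes "prob_space M" "centered_gaussian M Y"
  shows "integrable M (\<lambda>\<omega>. Y \<omega> ^ k)"
proof -
  interpret prob_space M by fact
  have m: "Y \<in> borel_measurable M"
    using assms(2) by (simp add: centered_gaussian_def)
  from assms(2) consider \<sigma> where "\<sigma> > 0" "distributed M lborel Y (\<lambda>x. ennreal (normal_density 0 \<sigma> x))"
    | "AE \<omega> in M. Y \<omega> = 0"
    by (auto simp: centered_gaussian_def)
  then show ?thesis
  proof cases
    case 1
    have "integrable lborel (\<lambda>x. normal_density 0 \<sigma> x * (x - 0) ^ k)"
      by (rule integrable_normal_moment[OF 1(1)])
    then show ?thesis
      using distributed_integrable[OF 1(2), of "\<lambda>x. x ^ k"] 1(1) by simp
  next
    \<comment> \<open>The point mass at 0 has no Lebesgue density, so integrability comes from a.e.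
      equality with the constant \<open>0 ^ k\<close>.\<close>
    case 2
    have "integrable M (\<lambda>\<omega>. (0::real) ^ k)"
      by simp
    moreover have "AE \<omega> in M. Y \<omega> ^ k = 0 ^ k"
      using 2 by eventually_elim simp
    ultimately show ?thesis
      using m by (subst integrable_cong_AE) auto
  qed
qed

lemma centered_gaussian_process_component:
  assumes "centered_gaussian_process M T X" "finite T" "t \<in> T"
  shows "centered_gaussian M (X t)"
proof -
  have "centered_gaussian M (\<lambda>\<omega>. \<Sum>s\<in>T. (if s = t then 1 else 0) * X s \<omega>)"
    using assms(1) unfolding centered_gaussian_process_def by (rule spec)
  moreover have "(\<Sum>s\<in>T. (if s = t then 1 else 0) * X s \<omega>) = X t \<omega>" for \<omega>
    using assms(2,3) by (simp add: if_distrib[of "\<lambda>z. z * _"] cong: if_cong)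
  ultimately show ?thesis
    by simp
qed

text \<open>Expand the square. The point is that the distances, hence \<open>min_dist\<close>, are
  functions of the covariance alone, so the threshold can be fixed before \<open>M\<close> and
  \<open>X\<close> are.\<close>

lemma canonical_dist_eq_covariance:
  assumes M: "prob_space M" and G: "centered_gaussian_process M T X" and T: "finite T"
    and st: "s \<in> T" "t \<in> T"
  shows "canonical_dist M X s t =
    sqrt (covariance M T X s s - 2 * covariance M T X s t + covariance M T X t t)"
proof -
  have sq: "integrable M (\<lambda>\<omega>. X r \<omega> * X r \<omega>)" and m [measurable]: "X r \<in> borel_measurable M"
    if "r \<in> T" for r
    using centered_gaussian_integrable_power[OF M centered_gaussian_process_component[OF G T that], of 2]
      centered_gaussian_process_measurable[OF G T that]
    by (simp_all add: power2_eq_square)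
  have st': "integrable M (\<lambda>\<omega>. X s \<omega> * X t \<omega>)"
  proof (rule Bochner_Integration.integrable_bound)
    show "integrable M (\<lambda>\<omega>. X s \<omega> * X s \<omega> + X t \<omega> * X t \<omega>)"
      using sq st by simp
    show "(\<lambda>\<omega>. X s \<omega> * X t \<omega>) \<in> borel_measurable M"
      using m st by simp
    \<comment> \<open>The cross term is dominated by the sum of the two squares, which are
      integrable as second moments.\<close>
    have "\<bar>x * y\<bar> \<le> \<bar>x * x + y * y\<bar>" for x y :: real
    proof -
      have "2 * \<bar>x * y\<bar> \<le> x * x + y * y"
        using sum_squares_bound[of "\<bar>x\<bar>" "\<bar>y\<bar>"] by (simp add: power2_eq_square abs_mult)
      then show ?thesis
        by linarith
    qed
    then show "AE \<omega> in M. norm (X s \<omega> * X t \<omega>) \<le> norm (X s \<omega> * X s \<omega> + X t \<omega> * X t \<omega>)"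
      by simp
  qed
  have "(\<integral>\<omega>. \<bar>X s \<omega> - X t \<omega>\<bar>\<^sup>2 \<partial>M)
      = (\<integral>\<omega>. X s \<omega> * X s \<omega> - 2 * (X s \<omega> * X t \<omega>) + X t \<omega> * X t \<omega> \<partial>M)"
    by (rule Bochner_Integration.integral_cong) (auto simp: power2_eq_square algebra_simps)
  also have "\<dots> = covariance M T X s s - 2 * covariance M T X s t + covariance M T X t t"
    using sq st st' by (simp add: covariance_def)
  finally show ?thesis
    by (simp add: canonical_dist_def)
qed

section \<open>Gibbs weights and the pointwise divergence bound\<close>

lemma partition_function_pos:
  assumes "finite T" "T \<noteq> {}"
  shows "0 < partition_function T X \<beta> \<omega>"
  using assms by (simp add: partition_function_def sum_pos)

lemma gibbs_pos:
  assumes "finite T" "T \<noteq> {}"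
  shows "0 < gibbs T X \<beta> \<omega> t"
  unfolding gibbs_def by (intro divide_pos_pos exp_gt_zero partition_function_pos assms)

lemma sum_gibbs:
  assumes "finite T" "T \<noteq> {}"
  shows "(\<Sum>t\<in>T. gibbs T X \<beta> \<omega> t) = 1"
  using partition_function_pos[OF assms, of X \<beta> \<omega>]
  by (simp add: gibbs_def sum_divide_distrib[symmetric] partition_function_def)

text \<open>Gibbs' inequality: apply \<open>ln x \<le> x - 1\<close> at
  \<open>x = \<nu> t / \<mu> t\<close> to each term; after summation the lower bound vanishes
  because the total masses agree.\<close>

lemma KL_div_nonneg:
  assumes "\<And>t. t \<in> T \<Longrightarrow> 0 < \<mu> t" "\<And>t. t \<in> T \<Longrightarrow> 0 < \<nu> t" "sum \<nu> T = sum \<mu> T"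
  shows "0 \<le> KL_div T \<mu> \<nu>"
proof -
  have "\<mu> t - \<nu> t \<le> \<mu> t * ln (\<mu> t / \<nu> t)" if "t \<in> T" for t
  proof -
    have p: "0 < \<mu> t" "0 < \<nu> t"
      using assms that by auto
    have "ln (\<nu> t / \<mu> t) \<le> \<nu> t / \<mu> t - 1"
      using p by (intro ln_le_minus_one) simp
    then have "1 - \<nu> t / \<mu> t \<le> ln (\<mu> t / \<nu> t)"
      using p by (simp add: ln_div)
    then have "\<mu> t * (1 - \<nu> t / \<mu> t) \<le> \<mu> t * ln (\<mu> t / \<nu> t)"
      using p by (intro mult_left_mono) auto
    moreover have "\<mu> t * (1 - \<nu> t / \<mu> t) = \<mu> t - \<nu> t"
      using p by (simp add: right_diff_distrib)
    ultimately show ?thesis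
      by simp
  qed
  then have "(\<Sum>t\<in>T. \<mu> t - \<nu> t) \<le> KL_div T \<mu> \<nu>"
    unfolding KL_div_def by (rule sum_mono)
  then show ?thesis
    using assms(3) by (simp add: sum_subtractf)
qed

text \<open>Since \<open>gibbs T X 0 \<omega>\<close> is uniform, the log-ratio at \<open>t\<close>
  is affine in \<open>X t \<omega>\<close>; average it with weights of total mass 1.\<close>

lemma KL_div_gibbs:
  assumes "finite T" "T \<noteq> {}"
  shows "KL_div T (gibbs T X \<beta> \<omega>) (gibbs T X 0 \<omega>) =
    \<beta> * (\<Sum>t\<in>T. gibbs T X \<beta> \<omega> t * X t \<omega>) - ln (partition_function T X \<beta> \<omega>) + ln (card T)"
proof -
  let ?Z = "partition_function T X \<beta> \<omega>" and ?p = "gibbs T X \<beta> \<omega>"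
  have Z: "0 < ?Z"
    by (rule partition_function_pos[OF assms])
  have n: "0 < card T"
    using assms by (simp add: card_gt_0_iff)
  have "ln (?p t / gibbs T X 0 \<omega> t) = \<beta> * X t \<omega> - ln ?Z + ln (card T)" for t
  proof -
    have "?p t / gibbs T X 0 \<omega> t = exp (\<beta> * X t \<omega>) / ?Z * card T"
      by (simp add: gibbs_def partition_function_def)
    then show ?thesis
      using Z n by (simp add: ln_mult ln_div)
  qed
  then have "KL_div T ?p (gibbs T X 0 \<omega>) =
      (\<Sum>t\<in>T. \<beta> * (?p t * X t \<omega>) + ?p t * (ln (card T) - ln ?Z))"
    unfolding KL_div_def by (simp only:) (simp add: algebra_simps)
  also have "\<dots> = \<beta> * (\<Sum>t\<in>T. ?p t * X t \<omega>) + (ln (card T) - ln ?Z)"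
    by (simp add: sum.distrib sum_distrib_left[symmetric] sum_distrib_right[symmetric] sum_gibbs[OF assms])
  finally show ?thesis
    by simp
qed

text \<open>The partition function is at least its single term at a maximiser of
  \<open>X\<close>.\<close>

lemma KL_div_gibbs_le:
  assumes "finite T" "T \<noteq> {}"
  shows "KL_div T (gibbs T X \<beta> \<omega>) (gibbs T X 0 \<omega>) \<le>
    ln (card T) - \<beta> * (Max ((\<lambda>t. X t \<omega>) ` T) - (\<Sum>t\<in>T. gibbs T X \<beta> \<omega> t * X t \<omega>))"
proof -
  have "Max ((\<lambda>t. X t \<omega>) ` T) \<in> (\<lambda>t. X t \<omega>) ` T"
    using assms by (intro Max_in) auto
  then obtain t where t: "t \<in> T" "Max ((\<lambda>t. X t \<omega>) ` T) = X t \<omega>"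
    by auto
  have "exp (\<beta> * X t \<omega>) \<le> partition_function T X \<beta> \<omega>"
    unfolding partition_function_def using assms t(1) by (intro member_le_sum) auto
  then have "\<beta> * X t \<omega> \<le> ln (partition_function T X \<beta> \<omega>)"
    using partition_function_pos[OF assms, of X \<beta> \<omega>] by (simp add: ln_ge_iff)
  then show ?thesis
    using t by (simp add: KL_div_gibbs[OF assms] algebra_simps)
qed

section \<open>Integrability and bounds in expectation\<close>

lemma integrable_Max:
  fixes X :: "'t \<Rightarrow> 'w \<Rightarrow> real"
  assumes "finite T" "T \<noteq> {}" "\<And>t. t \<in> T \<Longrightarrow> integrable M (X t)"
  shows "integrable M (\<lambda>\<omega>. Max ((\<lambda>t. X t \<omega>) ` T))"
  using assms
proof (induction T rule: finite_ne_induct)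
  case (insert t T)
  then have "integrable M (\<lambda>\<omega>. max (X t \<omega>) (Max ((\<lambda>t. X t \<omega>) ` T)))"
    by (intro integrable_max) auto
  with insert show ?case
    by simp
qed simp

text \<open>A Gibbs weight lies between 0 and 1, so the product is dominated by
  \<open>X t\<close>.\<close>

lemma integrable_gibbs_mult:
  fixes X :: "'t \<Rightarrow> 'w \<Rightarrow> real"
  assumes T: "finite T" "T \<noteq> {}" and X: "\<And>t. t \<in> T \<Longrightarrow> integrable M (X t)" and t: "t \<in> T"
  shows "integrable M (\<lambda>\<omega>. gibbs T X \<beta> \<omega> t * X t \<omega>)"
proof (rule Bochner_Integration.integrable_bound[OF X[OF t]])
  have m [measurable]: "X s \<in> borel_measurable M" if "s \<in> T" for s
    using X[OF that] by simp
  show "(\<lambda>\<omega>. gibbs T X \<beta> \<omega> t * X t \<omega>) \<in> borel_measurable M"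
    unfolding gibbs_def partition_function_def using t by measurable
  have "gibbs T X \<beta> \<omega> t \<le> 1" for \<omega>
    using member_le_sum[OF t, of "gibbs T X \<beta> \<omega>"] gibbs_pos[OF T, of X \<beta> \<omega>] T
    by (simp add: less_imp_le sum_gibbs[OF T])
  then have "\<bar>gibbs T X \<beta> \<omega> t\<bar> * \<bar>X t \<omega>\<bar> \<le> 1 * \<bar>X t \<omega>\<bar>" for \<omega>
    using gibbs_pos[OF T, of X \<beta> \<omega> t] by (intro mult_right_mono) auto
  then show "AE \<omega> in M. norm (gibbs T X \<beta> \<omega> t * X t \<omega>) \<le> norm (X t \<omega>)"
    by (simp add: abs_mult)
qed

lemma gibbs_average_eq:
  "gibbs_average M T X \<beta> = (\<integral>\<omega>. (\<Sum>t\<in>T. gibbs T X \<beta> \<omega> t * X t \<omega>) \<partial>M)"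
  unfolding gibbs_average_def
  by (rule Bochner_Integration.integral_cong) (auto simp: gibbs_def sum_divide_distrib mult.commute)

text \<open>A weighted mean never exceeds the maximum. The resulting sign of the gap allows it to be
  multiplied by a factor of at least 1 in the main argument.\<close>

lemma gibbs_average_le_Max:
  fixes X :: "'t \<Rightarrow> 'w \<Rightarrow> real"
  assumes T: "finite T" "T \<noteq> {}" and X: "\<And>t. t \<in> T \<Longrightarrow> integrable M (X t)"
  shows "gibbs_average M T X \<beta> \<le> (\<integral>\<omega>. Max ((\<lambda>t. X t \<omega>) ` T) \<partial>M)"
  unfolding gibbs_average_eq
proof (rule integral_mono)
  show "integrable M (\<lambda>\<omega>. \<Sum>t\<in>T. gibbs T X \<beta> \<omega> t * X t \<omega>)"
    by (intro Bochner_Integration.integrable_sum integrable_gibbs_mult[OF T X])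
  show "integrable M (\<lambda>\<omega>. Max ((\<lambda>t. X t \<omega>) ` T))"
    using integrable_Max[OF T X] .
  fix \<omega>
  have "(\<Sum>t\<in>T. gibbs T X \<beta> \<omega> t * X t \<omega>) \<le> (\<Sum>t\<in>T. gibbs T X \<beta> \<omega> t * Max ((\<lambda>t. X t \<omega>) ` T))"
    using gibbs_pos[OF T, of X \<beta> \<omega>] T by (intro sum_mono mult_left_mono) (auto simp: less_imp_le)
  then show "(\<Sum>t\<in>T. gibbs T X \<beta> \<omega> t * X t \<omega>) \<le> Max ((\<lambda>t. X t \<omega>) ` T)"
    by (simp add: sum_distrib_right[symmetric] sum_gibbs[OF T])
qed

lemma expected_KL_div_gibbs_le:
  fixes X :: "'t \<Rightarrow> 'w \<Rightarrow> real"
  assumes "prob_space M"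
    and T: "finite T" "T \<noteq> {}" and X: "\<And>t. t \<in> T \<Longrightarrow> integrable M (X t)"
  shows "(\<integral>\<omega>. KL_div T (gibbs T X \<beta> \<omega>) (gibbs T X 0 \<omega>) \<partial>M) \<le>
    ln (card T) - \<beta> * ((\<integral>\<omega>. Max ((\<lambda>t. X t \<omega>) ` T) \<partial>M) - gibbs_average M T X \<beta>)"
proof -
  interpret prob_space M by fact
  let ?m = "\<lambda>\<omega>. Max ((\<lambda>t. X t \<omega>) ` T)" and ?g = "\<lambda>\<omega>. \<Sum>t\<in>T. gibbs T X \<beta> \<omega> t * X t \<omega>"
  let ?D = "\<lambda>\<omega>. KL_div T (gibbs T X \<beta> \<omega>) (gibbs T X 0 \<omega>)"
  have int: "integrable M ?m" "integrable M ?g"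
    by (intro integrable_Max[OF T X] Bochner_Integration.integrable_sum integrable_gibbs_mult[OF T X];
        assumption)+
  have nonneg: "0 \<le> ?D \<omega>" for \<omega>
    by (rule KL_div_nonneg) (simp_all add: gibbs_pos[OF T] sum_gibbs[OF T])
  have le: "?D \<omega> \<le> ln (card T) - \<beta> * (?m \<omega> - ?g \<omega>)" for \<omega>
    by (rule KL_div_gibbs_le[OF T])
  \<comment> \<open>\<open>integral_mono'\<close> asks for an integrable, nonnegative upper bound;
    nonnegativity follows by chaining \<open>nonneg\<close> with \<open>le\<close>.\<close>
  have "(\<integral>\<omega>. ?D \<omega> \<partial>M) \<le> (\<integral>\<omega>. ln (card T) - \<beta> * (?m \<omega> - ?g \<omega>) \<partial>M)"
    using int le order_trans[OF nonneg le] by (intro integral_mono') auto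
  also have "\<dots> = ln (card T) - \<beta> * ((\<integral>\<omega>. ?m \<omega> \<partial>M) - gibbs_average M T X \<beta>)"
    using int by (simp add: gibbs_average_eq prob_space del: Bochner_Integration.integral_sum)
  finally show ?thesis .
qed

section \<open>The tangent bound and the final estimate\<close>

lemma sqrt_le_tangent:
  fixes L D :: real
  assumes "0 < L" "0 \<le> D"
  shows "sqrt D \<le> sqrt L - (L - D) / (2 * sqrt L)"
proof -
  \<comment> \<open>This is the nonnegativity of the square of \<open>sqrt D - sqrt L\<close>;
    dividing by \<open>2 * sqrt L\<close> turns it into the tangent bound.\<close>
  have "2 * sqrt D * sqrt L \<le> D + L"
    using sum_squares_bound[of "sqrt D" "sqrt L"] assms by simp
  moreover have "sqrt L * sqrt L = L"
    using assms by simp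
  ultimately have "L - D \<le> (sqrt L - sqrt D) * (2 * sqrt L)"
    unfolding left_diff_distrib by (simp only: mult.left_commute[of "sqrt L" 2] mult.left_commute[of "sqrt D" 2] mult.assoc)
  then have "(L - D) / (2 * sqrt L) \<le> sqrt L - sqrt D"
    using assms by (subst pos_divide_le_eq) auto
  then show ?thesis
    by simp
qed

text \<open>Dependence on the covariance structure is expressed by choosing the function
  \<open>\<beta>0\<close> before \<open>M\<close> and \<open>X\<close>; only \<open>c\<close> and
  \<open>T\<close> are fixed earlier.\<close>

theorem theorem2:
  fixes c :: real and T :: "'t set"
  assumes "0 < c" and "c < 1" and "sudakov_bound c"
    and "finite T" and "2 \<le> card T"
  shows "\<exists>\<beta>0 :: ('t \<Rightarrow> 't \<Rightarrow> real) \<Rightarrow> real.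
    (\<forall>K. 0 < \<beta>0 K) \<and>
    (\<forall>(M :: 'w measure) (X :: 't \<Rightarrow> 'w \<Rightarrow> real).
       prob_space M \<longrightarrow>
       centered_gaussian_process M T X \<longrightarrow>
       (\<forall>s\<in>T. \<forall>t\<in>T. s \<noteq> t \<longrightarrow> 0 < (\<integral>\<omega>. \<bar>X s \<omega> - X t \<omega>\<bar>\<^sup>2 \<partial>M)) \<longrightarrow>
       (\<forall>\<beta> \<ge> \<beta>0 (covariance M T X).
          gibbs_average M T X \<beta> \<ge>
            c * min_dist M T X *
              sqrt (\<integral>\<omega>. KL_div T (gibbs T X \<beta> \<omega>) (gibbs T X 0 \<omega>) \<partial>M)))"
proof (intro exI conjI allI impI)
  let ?L = "ln (real (card T))"
  \<comment> \<open>The minimal distance as read off from a covariance \<open>K\<close>;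
    \<open>a_eq\<close> identifies it with \<open>min_dist\<close> when \<open>K\<close> is the
    covariance of \<open>X\<close>.\<close>
  define a :: "('t \<Rightarrow> 't \<Rightarrow> real) \<Rightarrow> real" where
    "a = (\<lambda>K. Min {sqrt (K s s - 2 * K s t + K t t) | s t. s \<in> T \<and> t \<in> T \<and> s \<noteq> t})"
  \<comment> \<open>The \<open>max\<close> only matters for \<open>K\<close> that are not covariances, where \<open>a K \<le> 0\<close> is possible.\<close>
  define \<beta>0 where "\<beta>0 = (\<lambda>K. max 1 (2 * sqrt ?L / (c * a K)))"
  show "0 < \<beta>0 K" for K
    by (simp add: \<beta>0_def less_max_iff_disj)
  fix M :: "'w measure" and X :: "'t \<Rightarrow> 'w \<Rightarrow> real" and \<beta>
  assume M: "prob_space M" and G: "centered_gaussian_process M T X"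
    and sep: "\<forall>s\<in>T. \<forall>t\<in>T. s \<noteq> t \<longrightarrow> 0 < (\<integral>\<omega>. \<bar>X s \<omega> - X t \<omega>\<bar>\<^sup>2 \<partial>M)"
    and \<beta>: "\<beta>0 (covariance M T X) \<le> \<beta>"
  interpret prob_space M by (rule M)
  have T: "finite T" "T \<noteq> {}" and L: "0 < ?L"
    using assms(4,5) by auto
  have X: "integrable M (X t)" if "t \<in> T" for t
    using centered_gaussian_integrable_power[OF M centered_gaussian_process_component[OF G T(1) that], of 1]
    by simp
  define A where "A = {canonical_dist M X s t | s t. s \<in> T \<and> t \<in> T \<and> s \<noteq> t}"
  have "A \<subseteq> (\<lambda>(s, t). canonical_dist M X s t) ` (T \<times> T)"
    by (auto simp: A_def)
  then have finA: "finite A"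
    by (rule finite_subset) (simp add: T(1))
  \<comment> \<open>Two distinct points make the set under \<open>Min\<close> nonempty; without them
    its value would be unspecified.\<close>
  have "\<not> card T \<le> Suc 0"
    using assms(5) by simp
  then have neA: "A \<noteq> {}"
    unfolding card_le_Suc0_iff_eq[OF T(1)] A_def by blast
  have "0 < x" if "x \<in> A" for x
    using that sep by (auto simp: A_def canonical_dist_def)
  then have a_pos: "0 < min_dist M T X"
    using finA neA by (simp add: min_dist_def A_def[symmetric])
  have a_le: "min_dist M T X \<le> canonical_dist M X s t" if "s \<in> T" "t \<in> T" "s \<noteq> t" for s t
    unfolding min_dist_def A_def[symmetric] using that finA by (intro Min_le) (auto simp: A_def)
  have a_eq: "a (covariance M T X) = min_dist M T X"
    unfolding a_def min_dist_def
    using canonical_dist_eq_covariance[OF M G T(1)]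
    by (intro arg_cong[where f = Min] Collect_cong) (metis (no_types, lifting))
  define k where "k = c * min_dist M T X"
  have k: "0 < k"
    using a_pos assms(1) by (simp add: k_def)
  let ?m = "\<integral>\<omega>. Max ((\<lambda>t. X t \<omega>) ` T) \<partial>M" and ?g = "gibbs_average M T X \<beta>"
  let ?D = "\<integral>\<omega>. KL_div T (gibbs T X \<beta> \<omega>) (gibbs T X 0 \<omega>) \<partial>M"
  have "2 * sqrt ?L / k \<le> \<beta>"
    using \<beta> by (simp add: \<beta>0_def a_eq k_def)
  then have "1 \<le> k * \<beta> / (2 * sqrt ?L)"
    using k L by (simp add: field_simps)
  \<comment> \<open>The threshold makes the factor at least 1, and the gap is nonnegative. The
    factor supplies the \<open>\<beta>\<close> of the divergence bound and the denominator of the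
    tangent bound.\<close>
  then have "?m - ?g \<le> k * \<beta> / (2 * sqrt ?L) * (?m - ?g)"
    using mult_right_mono[of 1 _ "?m - ?g"] gibbs_average_le_Max[OF T X] by fastforce
  also have "\<dots> = k * (\<beta> * (?m - ?g) / (2 * sqrt ?L))"
    by simp
  also have "\<dots> \<le> k * ((?L - ?D) / (2 * sqrt ?L))"
  proof (intro mult_left_mono divide_right_mono)
    show "\<beta> * (?m - ?g) \<le> ?L - ?D"
      using expected_KL_div_gibbs_le[where X = X and \<beta> = \<beta>, OF M T X] by simp
  qed (use k L in auto)
  also have "\<dots> \<le> k * (sqrt ?L - sqrt ?D)"
  proof (intro mult_left_mono)
    have "0 \<le> ?D"
      by (intro Bochner_Integration.integral_nonneg KL_div_nonneg) (simp_all add: gibbs_pos[OF T] sum_gibbs[OF T])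
    then show "(?L - ?D) / (2 * sqrt ?L) \<le> sqrt ?L - sqrt ?D"
      using sqrt_le_tangent[OF L, of ?D] by linarith
  qed (use k in auto)
  finally have "?m - ?g \<le> k * sqrt ?L - k * sqrt ?D"
    by (simp add: right_diff_distrib)
  \<comment> \<open>Sudakov's bound at separation \<open>min_dist M T X\<close>; added to the
    previous inequality, it cancels \<open>?m\<close> and \<open>k * sqrt ?L\<close>.\<close>
  moreover have "k * sqrt ?L \<le> ?m"
    unfolding k_def by (rule sudakov_boundD[OF assms(3-5) M G a_pos a_le])
  ultimately show "c * min_dist M T X * sqrt ?D \<le> ?g"
    by (simp add: k_def)
qed

end
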